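(* Let $p$ be a prime, and let $a,n\in\mathbb Z^+$, $l\in\mathbb N$ and $r\in\mathbb Z$. Then $$\mathrm{ord}_p\left(\left\{\begin{matrix} pn\\ pr\end{matrix}\right\}_{l,p^{a+1}}-\left\{\begin{matrix} n\\ r\end{matrix}\right\}_{l,p^{a}}\right)\geqslant\frac{p-1}p\bigl(2\,\mathrm{ord}_p(n)+\delta\bigr),$$ where $\delta=0$ if $p=2$, $\delta=1$ if $p=3$, and $\delta=2$ if $p\geqslant5$.
   Context: $\mathbb N=\{0,1,2,\ldots\}$; $\mathrm{ord}_p(x)=\sup\{m\in\mathbb N: p^m\mid x\}$ (so $\mathrm{ord}_p(0)=\infty$). Binomial coefficients: $\binom x0=1$, $\binom xk=x(x-1)\cdots(x-k+1)/k!$ for $k\in\mathbb Z^+$ (for rational $x$), and $\binom xk=0$ for negative integers $k$. For a prime $p$, $b\in\mathbb Z^+$, $l,n\in\mathbb N$ and $r\in\mathbb Z$, $$\left\{\begin{matrix} n\\ r\end{matrix}\right\}_{l,p^{b}}:=p^{-\left\lfloor\frac{n-p^{b-1}-lp^{b}}{\phi(p^{b})}\right\rfloor}\sum_{k\equiv r\,(\mathrm{mod}\ p^{b})}(-1)^k\binom nk\binom{(k-r)/p^{b}}l,$$ the sum over all integers $k\equiv r\pmod{p^b}$, with $\phi$ Euler's totient function. These numbers are integers. *)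

theory Defs
  imports "HOL-Number_Theory.Number_Theory" "HOL-Library.Extended_Real"
begin

text \<open>
  The order is defined on the rationals because the numbers it is applied to are given by a
  rational formula; divisibility is divisibility in the integers, i.e. the quotient of \<open>x\<close> by
  \<open>p ^ m\<close> is an integer. If \<open>x\<close> is not an integer, the set is empty and its supremum
  in \<^typ>\<open>ereal\<close> is minus infinity, so a nonnegative lower bound on the order of \<open>x\<close>
  includes the integrality of \<open>x\<close>.
\<close>

definition padic_ord :: "nat \<Rightarrow> rat \<Rightarrow> ereal" where
  "padic_ord p x = (SUP m\<in>{m::nat. \<exists>z::int. x = of_nat (p ^ m) * of_int z}. ereal (real m))"

text \<open>
  The sum over all integers \<open>k\<close> congruent to \<open>r\<close> reduces to \<open>0 \<le> k \<le> n\<close>, as the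
  binomial coefficient of \<open>n\<close> over \<open>k\<close> vanishes otherwise. The definition is meant for \<open>b > 0\<close>.
\<close>

definition bracket :: "nat \<Rightarrow> nat \<Rightarrow> nat \<Rightarrow> nat \<Rightarrow> int \<Rightarrow> rat" where
  "bracket p b l n r =
     of_nat p powi (- \<lfloor>(of_nat n - of_nat (p ^ (b - 1)) - of_nat (l * p ^ b)) /
                        (of_nat (totient (p ^ b)) :: rat)\<rfloor>) *
     (\<Sum>k | k \<le> n \<and> [int k = r] (mod int (p ^ b)).
        (- 1) ^ k * of_nat (n choose k) * ((of_int (int k - r) / of_nat (p ^ b)) gchoose l))"

definition delta :: "nat \<Rightarrow> nat" where
  "delta p = (if p = 2 then 0 else if p = 3 then 1 else 2)"

lemma padic_ord_zero: "padic_ord p 0 = \<infinity>"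
proof -
  have "{m::nat. \<exists>z::int. (0::rat) = of_nat (p ^ m) * of_int z} = UNIV"
    by (auto intro: exI[of _ 0])
  then show ?thesis
    unfolding padic_ord_def
    by (auto intro!: SUP_PInfty)
qed

lemma padic_ord_of_int:
  assumes "prime p" "x \<noteq> 0"
  shows "padic_ord p (of_int x) = ereal (real (multiplicity (int p) x))"
proof -
  have eq: "(\<exists>z::int. (of_int x :: rat) = of_nat (p ^ m) * of_int z) \<longleftrightarrow>
              m \<le> multiplicity (int p) x" for m
  proof -
    have "(\<exists>z::int. (of_int x :: rat) = of_nat (p ^ m) * of_int z) \<longleftrightarrow>
            (\<exists>z::int. (of_int x :: rat) = of_int (int p ^ m * z))"
      by simp
    also have "\<dots> \<longleftrightarrow> int p ^ m dvd x"
      unfolding of_int_eq_iff dvd_def ..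
    also have "\<dots> \<longleftrightarrow> m \<le> multiplicity (int p) x"
      using assms by (intro power_dvd_iff_le_multiplicity) auto
    finally show ?thesis .
  qed
  show ?thesis
    unfolding padic_ord_def eq
  proof (rule antisym)
    show "(SUP m\<in>{m. m \<le> multiplicity (int p) x}. ereal (real m))
            \<le> ereal (real (multiplicity (int p) x))"
      by (rule SUP_least) simp
    show "ereal (real (multiplicity (int p) x))
            \<le> (SUP m\<in>{m. m \<le> multiplicity (int p) x}. ereal (real m))"
      by (rule SUP_upper) simp
  qed
qed

end

theory Submission
  imports Defs "HOL-Computational_Algebra.Polynomial"
begin

text \<open>
  Both brackets carry the same power of \<open>p\<close>, so their difference is that power times
  \<open>\<Sum>k. G k * w k\<close>, where \<open>G k = (-1)^(p k) * (p n choose p k) - (-1)^k * (n choose k)\<close> and the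
  weight \<open>w\<close> selects \<open>k \<equiv> r\<close> modulo \<open>p ^ a\<close>. Expanding \<open>\<Sum>k. G k * y ^ k\<close> at \<open>y = 1\<close> turns
  the sum into \<open>\<Sum>m. f m * S m\<close>, where \<open>f m = \<Sum>k. G k * (k choose m)\<close> and \<open>S m\<close> is the
  \<open>w\<close>-weighted coefficient sum of \<open>(y - 1) ^ m\<close>. Two bounds on \<open>f m\<close> are combined. A refinement
  of the congruences of Jacobsthal type shows that every \<open>G k\<close>, hence every \<open>f m\<close>, is divisible by
  \<open>p ^ (2 ord n + delta + 1)\<close>. For \<open>m < n\<close>, moreover, \<open>f m\<close> is itself an alternating binomial sum
  over the multiples of \<open>p\<close> (the part from \<open>n choose k\<close> vanishes), so the integrality of the brackets
  with \<open>b = 1\<close> and \<open>l = m\<close> makes it highly divisible when \<open>n - m\<close> is large.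
\<close>

section \<open>Coefficient sums over a residue class\<close>

lemma power_add_second_order:
  fixes u v :: "'a::comm_ring_1"
  shows "\<exists>c. (u + v) ^ Suc n = u ^ Suc n + of_nat (Suc n) * v * u ^ n + v ^ 2 * c"
proof (induction n)
  case 0
  show ?case by (rule exI[of _ 0]) simp
next
  case (Suc n)
  then obtain c where c: "(u + v) ^ Suc n = u ^ Suc n + of_nat (Suc n) * v * u ^ n + v ^ 2 * c"
    by blast
  have "(u + v) ^ Suc (Suc n) = (u + v) * (u + v) ^ Suc n" by simp
  also have "\<dots> = u ^ Suc (Suc n) + of_nat (Suc (Suc n)) * v * u ^ Suc n
      + v ^ 2 * (of_nat (Suc n) * u ^ n + (u + v) * c)"
    unfolding c by (simp add: algebra_simps power2_eq_square)
  finally show ?case by blast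
qed

text \<open>The coefficients of \<open>(1 - X) ^ p - (1 - X ^ p)\<close> are multiples of
  \<open>p\<close>, and this polynomial vanishes at \<open>X = 1\<close>. The second fact supplies
  the extra factor \<open>1 - z\<close> in the error term; \<open>z\<close> is then substituted for
  \<open>X\<close>.\<close>

lemma one_minus_power_prime:
  fixes z :: "int poly"
  assumes "prime p"
  shows "\<exists>w. (1 - z) ^ p = 1 - z ^ p + of_nat p * (1 - z) * w"
proof -
  define d :: "int poly" where "d = [:1, -1:] ^ p - (1 - monom 1 p)"
  have p: "p > 0" using assms prime_gt_0_nat by blast
  have "int p dvd coeff d k" for k
  proof -
    consider "k = 0" | "k = p" | "0 < k" "k < p" | "p < k" by linarith
    then show ?thesis
    proof cases
      case 1
      with p show ?thesis by (simp add: d_def coeff_linear_poly_power)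
    next
      case 2
      then have "coeff d k = (-1) ^ p + 1"
        using p by (simp add: d_def coeff_linear_poly_power)
      \<comment> \<open>The coefficient is 0 for odd \<open>p\<close> and 2 for
        \<open>p = 2\<close>.\<close>
      then show ?thesis
        using assms prime_odd_nat[of p] prime_ge_2_nat[of p] by (cases "p = 2") auto
    next
      case 3
      then have "p dvd p choose k" using assms by (intro dvd_choose_prime) auto
      with 3 show ?thesis
        by (simp add: d_def coeff_linear_poly_power)
    next
      case 4
      have "degree ([:1, -1 :: int:] ^ p) = p" by (simp add: degree_power_eq)
      with 4 p have "coeff ([:1, -1 :: int:] ^ p) k = 0" by (intro coeff_eq_0) auto
      with 4 show ?thesis by (simp add: d_def)
    qed
  qed
  then have "[:int p:] dvd d" by (simp add: const_poly_dvd_iff)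
  then obtain h where h: "d = [:int p:] * h" by (elim dvdE)
  have "poly d 1 = 0" using p by (simp add: d_def poly_monom)
  then have "poly h 1 = 0" using h p by simp
  then obtain w where w: "h = [:-1, 1:] * w" using poly_eq_0_iff_dvd[of h 1] by (auto elim: dvdE)
  have X: "monom (1::int) p = [:0, 1:] ^ p" by (simp add: monom_altdef)
  have "[:1, -1:] ^ p = 1 - [:0, 1:] ^ p + [:int p:] * ([:-1, 1:] * w)"
    using h w d_def X by (simp add: algebra_simps)
  then have "pcompose ([:1, -1:] ^ p) z = pcompose (1 - [:0, 1:] ^ p + [:int p:] * ([:-1, 1:] * w)) z"
    by simp
  moreover have "pcompose [:1, -1:] z = 1 - z" "pcompose [:-1, 1:] z = z - 1"
    by (simp_all add: pcompose_pCons one_pCons)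
  moreover have "pcompose (f ^ n) z = pcompose f z ^ n" for f :: "int poly" and n
    by (induction n) (simp_all add: pcompose_1 pcompose_mult)
  ultimately have "(1 - z) ^ p = 1 - z ^ p + of_nat p * ((z - 1) * pcompose w z)"
    by (simp only: pcompose_add pcompose_diff pcompose_mult pcompose_1
        pcompose_const of_nat_poly)
       (simp add: pcompose_pCons of_nat_poly)
  also have "\<dots> = 1 - z ^ p + of_nat p * (1 - z) * (- pcompose w z)"
    by (simp add: algebra_simps)
  finally show ?thesis by blast
qed

text \<open>What matters is the factor \<open>(1 - z) ^ (p ^ c)\<close> kept next to the single
  \<open>p\<close>: gaining one \<open>p\<close> then costs only \<open>p ^ Suc c - p ^ c\<close>
  factors \<open>1 - z\<close>, which is the totient of \<open>p ^ Suc c\<close>.\<close>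

lemma one_minus_power_prime_power:
  fixes z :: "int poly"
  assumes "prime p"
  shows "\<exists>v w. (1 - z) ^ (p ^ Suc c) = 1 - z ^ (p ^ Suc c)
            + of_nat p * (1 - z) ^ (p ^ c) * v + of_nat p ^ 2 * w"
proof -
  \<comment> \<open>The refined form at \<open>Suc c\<close> needs only the plain congruence modulo
    \<open>p\<close> at \<open>c\<close>, so \<open>first\<close> can be proved by induction from
    \<open>step\<close>.\<close>
  have step: "\<exists>v w. (1 - z) ^ (p ^ Suc c) = 1 - z ^ (p ^ Suc c)
            + of_nat p * (1 - z) ^ (p ^ c) * v + of_nat p ^ 2 * w"
    if ex: "\<exists>w. (1 - z) ^ (p ^ c) = 1 - z ^ (p ^ c) + of_nat p * w" for c
  proof -
    obtain b where b: "(1 - z) ^ (p ^ c) = 1 - z ^ (p ^ c) + of_nat p * b"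
      using ex by blast
    obtain m where m: "p = Suc m" using assms prime_gt_0_nat gr0_conv_Suc by blast
    define u where "u = 1 - z ^ (p ^ c)"
    \<comment> \<open>The increment and the exponent both carry a factor \<open>p\<close>, so
      everything beyond \<open>u ^ p\<close> is divisible by \<open>p ^ 2\<close>.\<close>
    obtain s where s: "(u + of_nat p * b) ^ p
        = u ^ p + of_nat p * (of_nat p * b) * u ^ m + (of_nat p * b) ^ 2 * s"
      using power_add_second_order[of u "of_nat p * b" m] unfolding m by blast
    obtain v where "u ^ p = 1 - (z ^ (p ^ c)) ^ p + of_nat p * u * v"
      using one_minus_power_prime[OF assms, of "z ^ (p ^ c)"] unfolding u_def by blast
    then have v: "u ^ p = 1 - z ^ (p ^ Suc c) + of_nat p * u * v"
      by (simp add: power_mult[symmetric] mult.commute)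
    have u: "u = (1 - z) ^ (p ^ c) - of_nat p * b" using b by (simp add: u_def)
    have "(1 - z) ^ (p ^ Suc c) = (u + of_nat p * b) ^ p"
      using b by (simp add: u_def power_mult mult.commute[of p])
    also have "\<dots> = 1 - z ^ (p ^ Suc c) + of_nat p * u * v
        + of_nat p ^ 2 * (b * u ^ m + b ^ 2 * s)"
      unfolding s v by (simp add: algebra_simps power2_eq_square)
    also have "of_nat p * u * v = of_nat p * (1 - z) ^ (p ^ c) * v - of_nat p ^ 2 * (b * v)"
      unfolding u by (simp add: algebra_simps power2_eq_square)
    finally have "(1 - z) ^ (p ^ Suc c) = 1 - z ^ (p ^ Suc c) + of_nat p * (1 - z) ^ (p ^ c) * v
        + of_nat p ^ 2 * (b * u ^ m + b ^ 2 * s - b * v)"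
      by (simp add: algebra_simps)
    then show ?thesis by blast
  qed
  have first: "\<exists>w. (1 - z) ^ (p ^ c) = 1 - z ^ (p ^ c) + of_nat p * w" for c
  proof (induction c)
    case 0
    show ?case by (rule exI[of _ 0]) simp
  next
    case (Suc c)
    then obtain v w where "(1 - z) ^ (p ^ Suc c) = 1 - z ^ (p ^ Suc c)
            + of_nat p * (1 - z) ^ (p ^ c) * v + of_nat p ^ 2 * w"
      using step by blast
    then have "(1 - z) ^ (p ^ Suc c) = 1 - z ^ (p ^ Suc c)
            + of_nat p * ((1 - z) ^ (p ^ c) * v + of_nat p * w)"
      by (simp add: algebra_simps power2_eq_square)
    then show ?case by blast
  qed
  show "\<exists>v w. (1 - z) ^ (p ^ Suc c) = 1 - z ^ (p ^ Suc c)
            + of_nat p * (1 - z) ^ (p ^ c) * v + of_nat p ^ 2 * w"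
    by (rule step[OF first])
qed

text \<open>The linear functional with \<open>y ^ k\<close> sent to \<open>g k\<close>. It turns
  polynomial identities into identities between weighted sums; at \<open>(1 - y) ^ n\<close> it
  yields the alternating binomial sums of the brackets.\<close>

definition coeff_sum_with :: "(nat \<Rightarrow> int) \<Rightarrow> int poly \<Rightarrow> int" where
  "coeff_sum_with g f = (\<Sum>k\<le>degree f. coeff f k * g k)"

lemma coeff_sum_with_eq:
  assumes "degree f \<le> n"
  shows "coeff_sum_with g f = (\<Sum>k\<le>n. coeff f k * g k)"
  unfolding coeff_sum_with_def
  using assms by (intro sum.mono_neutral_left) (auto simp: coeff_eq_0)

lemma coeff_sum_with_add:
  "coeff_sum_with g (f1 + f2) = coeff_sum_with g f1 + coeff_sum_with g f2"
proof -
  define n where "n = max (degree f1) (degree f2)"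
  have "degree f1 \<le> n" "degree f2 \<le> n" "degree (f1 + f2) \<le> n"
    by (auto simp: n_def intro: degree_add_le_max)
  then show ?thesis
    by (simp add: coeff_sum_with_eq sum.distrib algebra_simps)
qed

lemma coeff_sum_with_smult: "coeff_sum_with g (smult c f) = c * coeff_sum_with g f"
  using degree_smult_le[of c f]
  by (simp add: coeff_sum_with_eq[of _ "degree f"] sum_distrib_left mult.assoc)

lemma coeff_sum_with_of_nat_mult:
  "coeff_sum_with g (of_nat c * f) = int c * coeff_sum_with g f"
  by (simp add: of_nat_poly coeff_sum_with_smult)

lemma coeff_sum_with_minus: "coeff_sum_with g (- f) = - coeff_sum_with g f"
  using coeff_sum_with_smult[of g "-1" f] by simp

lemma coeff_sum_with_monom_mult:
  "coeff_sum_with g (monom 1 q * f) = coeff_sum_with (\<lambda>k. g (k + q)) f"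
proof -
  have "degree (monom 1 q * f) \<le> degree f + q"
    by (rule order.trans[OF degree_mult_le]) (simp add: degree_monom_eq)
  then have "coeff_sum_with g (monom 1 q * f)
      = (\<Sum>k\<le>degree f + q. (if k < q then 0 else coeff f (k - q)) * g k)"
    by (simp add: coeff_sum_with_eq coeff_monom_mult cong: if_cong)
  also have "\<dots> = (\<Sum>k\<in>{q..degree f + q}. coeff f (k - q) * g k)"
    by (intro sum.mono_neutral_cong_right) auto
  also have "\<dots> = (\<Sum>k\<le>degree f. coeff f k * g (k + q))"
    by (rule sum.reindex_bij_witness[of _ "\<lambda>k. k + q" "\<lambda>k. k - q"]) auto
  finally show ?thesis by (simp add: coeff_sum_with_def)
qed

lemma coeff_sum_with_one_minus_monom_mult:
  "coeff_sum_with g ((1 - monom 1 q) * f) = coeff_sum_with (\<lambda>k. g k - g (k + q)) f"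
proof -
  have "(1 - monom 1 q) * f = f + - (monom 1 q * f)" by (simp add: algebra_simps)
  then have "coeff_sum_with g ((1 - monom 1 q) * f)
      = coeff_sum_with g f - coeff_sum_with (\<lambda>k. g (k + q)) f"
    by (simp only: coeff_sum_with_add coeff_sum_with_minus coeff_sum_with_monom_mult)
  then show ?thesis
    by (simp add: coeff_sum_with_def sum_subtractf algebra_simps)
qed

text \<open>The floor is exact, and only serves to obtain an integer.\<close>

definition int_choose :: "int \<Rightarrow> nat \<Rightarrow> int" where
  "int_choose x l = \<lfloor>(of_int x :: rat) gchoose l\<rfloor>"

lemma of_int_int_choose: "(of_int (int_choose x l) :: rat) = of_int x gchoose l"
  unfolding int_choose_def by (simp only: of_int_gbinomial[symmetric] floor_of_int)

lemma int_choose_0 [simp]: "int_choose x 0 = 1"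
  by (simp add: int_choose_def)

lemma int_choose_Suc_Suc:
  "int_choose (x + 1) (Suc l) = int_choose x l + int_choose x (Suc l)"
proof -
  have "(of_int (int_choose (x + 1) (Suc l)) :: rat)
      = of_int (int_choose x l + int_choose x (Suc l))"
    by (simp only: of_int_add of_int_int_choose of_int_1 gbinomial_Suc_Suc)
  then show ?thesis by (simp only: of_int_eq_iff)
qed

lemma int_choose_of_nat: "int_choose (int n) l = int (n choose l)"
  unfolding int_choose_def by (simp add: binomial_gbinomial[symmetric])

text \<open>The weight of the bracket sum for \<open>q = p ^ b\<close>, extended by zero off the
  residue class. The division is exact wherever it is used.\<close>

definition choose_weight :: "nat \<Rightarrow> nat \<Rightarrow> int \<Rightarrow> nat \<Rightarrow> int" where
  "choose_weight q l r k =
     (if int q dvd int k - r then int_choose ((int k - r) div int q) l else 0)"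

lemma choose_weight_shift:
  assumes "q > 0"
  shows "choose_weight q 0 r (k + q) = choose_weight q 0 r k"
    and "choose_weight q (Suc l) r (k + q)
           = choose_weight q (Suc l) r k + choose_weight q l r k"
proof -
  have e: "int (k + q) - r = (int k - r) + int q" by simp
  have d: "int q dvd int (k + q) - r \<longleftrightarrow> int q dvd int k - r"
    unfolding e by simp
  have "(int (k + q) - r) div int q = (int k - r) div int q + 1"
    unfolding e using assms by simp
  then show "choose_weight q 0 r (k + q) = choose_weight q 0 r k"
    and "choose_weight q (Suc l) r (k + q)
           = choose_weight q (Suc l) r k + choose_weight q l r k"
    by (cases "int q dvd int k - r"; simp only: choose_weight_def d int_choose_Suc_Suc int_choose_0; simp)+
qed

text \<open>Multiplying by \<open>1 - y ^ q\<close> takes the difference of the weight with step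
  \<open>q\<close>; by Pascal's rule this lowers \<open>l\<close> by one and kills the weight for
  \<open>l = 0\<close>.\<close>

lemma coeff_sum_choose_weight_one_minus_monom:
  assumes "q > 0"
  shows "coeff_sum_with (choose_weight q 0 r) ((1 - monom 1 q) * f) = 0"
    and "coeff_sum_with (choose_weight q (Suc l) r) ((1 - monom 1 q) * f)
           = - coeff_sum_with (choose_weight q l r) f"
  unfolding coeff_sum_with_one_minus_monom_mult
  by (simp_all add: choose_weight_shift[OF assms] coeff_sum_with_def sum_negf)

text \<open>Expanding \<open>(1 - y) ^ (p ^ Suc c)\<close> trades \<open>p ^ Suc c\<close> factors \<open>1 - y\<close> for a step from \<open>l\<close>
  to \<open>l - 1\<close>, for \<open>p ^ c\<close> such factors and a factor \<open>p\<close>, or for a factor \<open>p\<^sup>2\<close>.\<close>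

lemma prime_power_dvd_coeff_sum_choose_weight:
  assumes p: "prime p"
    and "p ^ c + l * p ^ Suc c + p ^ c * (p - 1) * m \<le> n"
  shows "int p ^ m dvd coeff_sum_with (choose_weight (p ^ Suc c) l r) ([:1, -1:] ^ n * f)"
  using assms(2)
proof (induction m arbitrary: l n f rule: less_induct)
  case (less m)
  have ih: "int p ^ m' dvd coeff_sum_with (choose_weight (p ^ Suc c) l r) ([:1, -1:] ^ n * f)"
    if "m' < m" "p ^ c + l * p ^ Suc c + p ^ c * (p - 1) * m' \<le> n" for m' l n f
    using less.IH that by blast
  show ?case
  proof (cases m)
    case 0
    then show ?thesis by simp
  next
    case (Suc m')
    define \<phi> where "\<phi> = p ^ c * (p - 1)"
    define q where "q = p ^ Suc c"
    have p2: "p \<ge> 2" using p by (rule prime_ge_2_nat)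
    have q: "q = p ^ c + \<phi>" using p2 by (cases p) (simp_all add: q_def \<phi>_def)
    have \<phi>: "p ^ c \<le> \<phi>" unfolding \<phi>_def using p2 by simp
    have "q > 0" using p2 by (simp add: q_def)
    define Y where "Y = [:1, -1 :: int:]"
    have Y: "Y = 1 - monom 1 1" by (simp add: Y_def monom_altdef one_pCons)
    obtain v w where "(1 - monom 1 1) ^ (p ^ Suc c) = 1 - monom (1::int) 1 ^ (p ^ Suc c)
            + of_nat p * (1 - monom 1 1) ^ (p ^ c) * v + of_nat p ^ 2 * w"
      using one_minus_power_prime_power[OF p] by blast
    then have vw: "Y ^ q = (1 - monom 1 q) + of_nat p * Y ^ (p ^ c) * v + of_nat p ^ 2 * w"
      by (simp add: Y q_def monom_power)
    have ih': "int p ^ m' dvd coeff_sum_with (choose_weight q l r) (Y ^ n * f)"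
      if "m' < m" "p ^ c + l * q + \<phi> * m' \<le> n" for m' l n f
      using ih that unfolding \<phi>_def q_def Y_def .
    \<comment> \<open>The two terms carrying a factor \<open>p\<close> fall under the induction on
      \<open>m\<close>. The term with \<open>1 - monom 1 q\<close> keeps the exponent
      \<open>m\<close>, so it is left as a premise and discharged by an inner induction on
      \<open>l\<close>.\<close>
    have split: "int p ^ m dvd coeff_sum_with (choose_weight q l r) (Y ^ n * f)"
      if n: "p ^ c + l * q + \<phi> * m \<le> n"
        and dvd: "int p ^ m dvd coeff_sum_with (choose_weight q l r) ((1 - monom 1 q) * (Y ^ (n - q) * f))"
      for n f l
    proof -
      let ?S = "coeff_sum_with (choose_weight q l r)"
      define N where "N = n - q"
      have n': "l * q + \<phi> * m' \<le> N" "n = q + N" using n q by (auto simp: N_def Suc)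
      have "Y ^ n * f = (1 - monom 1 q) * (Y ^ N * f)
          + (of_nat p * (Y ^ (p ^ c + N) * (v * f)) + of_nat p * (of_nat p * (Y ^ N * (w * f))))"
        unfolding n'(2) power_add vw by (simp add: algebra_simps power2_eq_square)
      then have eq: "?S (Y ^ n * f) = ?S ((1 - monom 1 q) * (Y ^ N * f))
          + (int p * ?S (Y ^ (p ^ c + N) * (v * f)) + int p * (int p * ?S (Y ^ N * (w * f))))"
        by (simp only: coeff_sum_with_add coeff_sum_with_of_nat_mult)
      have "int p ^ m' dvd ?S (Y ^ (p ^ c + N) * (v * f))"
        by (rule ih') (use n' in \<open>auto simp: Suc\<close>)
      then have 1: "int p ^ m dvd int p * ?S (Y ^ (p ^ c + N) * (v * f))"
        by (simp add: Suc)
      \<comment> \<open>This term has lost all \<open>q\<close> factors, \<open>p ^ c\<close> more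
        than the previous one. Its second \<open>p\<close> allows lowering the exponent once more,
        which frees \<phi> factors, and \<open>p ^ c\<close> is at most \<phi>.\<close>
      have "int p ^ m' dvd int p * ?S (Y ^ N * (w * f))"
      proof (cases m')
        case 0
        then show ?thesis by simp
      next
        case (Suc k)
        have "int p ^ k dvd ?S (Y ^ N * (w * f))"
          by (rule ih') (use n' \<phi> in \<open>auto simp: Suc \<open>m = Suc m'\<close>\<close>)
        then show ?thesis by (simp add: Suc)
      qed
      then have 2: "int p ^ m dvd int p * (int p * ?S (Y ^ N * (w * f)))"
        by (simp add: Suc)
      show ?thesis unfolding eq
        using dvd 1 2 by (intro dvd_add) (simp_all add: N_def)
    qed
    have "int p ^ m dvd coeff_sum_with (choose_weight q l r) (Y ^ n * f)"
      if "p ^ c + l * q + \<phi> * m \<le> n" for n f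
      using that
    proof (induction l arbitrary: n f)
      case (0 n f)
      then show ?case
        by (intro split) (simp_all add: coeff_sum_choose_weight_one_minus_monom[OF \<open>q > 0\<close>])
    next
      case (Suc l n f)
      have "int p ^ m dvd coeff_sum_with (choose_weight q l r) (Y ^ (n - q) * f)"
        by (rule Suc.IH) (use Suc.prems in auto)
      then show ?case using Suc.prems
        by (intro split) (simp_all add: coeff_sum_choose_weight_one_minus_monom[OF \<open>q > 0\<close>])
    qed
    then show ?thesis using less.prems by (simp add: \<phi>_def q_def Y_def)
  qed
qed

section \<open>Signed binomial coefficients modulo prime powers\<close>

definition nonmultiples_below :: "nat \<Rightarrow> nat \<Rightarrow> nat set" where
  "nonmultiples_below p m = {j. j < m \<and> \<not> p dvd j}"

lemma finite_nonmultiples_below [simp]: "finite (nonmultiples_below p m)"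
  by (simp add: nonmultiples_below_def)

lemma lessThan_mult_split:
  assumes "p > 0"
  shows "{..<p * k} = (\<lambda>i. p * i) ` {..<k} \<union> nonmultiples_below p (p * k)"
    and "(\<lambda>i. p * i) ` {..<k} \<inter> nonmultiples_below p (p * k) = {}"
    and "inj_on (\<lambda>i. p * i) {..<k}"
  using assms by (auto simp: nonmultiples_below_def inj_on_def)

lemma card_nonmultiples_below:
  assumes "p > 0"
  shows "card (nonmultiples_below p (p * k)) = k * (p - 1)"
proof -
  note split = lessThan_mult_split[OF assms, of k]
  have "p * k = card ((\<lambda>i. p * i) ` {..<k} \<union> nonmultiples_below p (p * k))"
    by (simp flip: split(1))
  also have "\<dots> = k + card (nonmultiples_below p (p * k))"
    using split(2,3) by (subst card_Un_disjoint) (auto simp: card_image)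
  finally have "p * k = k + card (nonmultiples_below p (p * k))" .
  then show ?thesis using assms by (cases p) simp_all
qed

lemma prod_lessThan_mult_split:
  fixes f :: "nat \<Rightarrow> 'a::comm_monoid_mult"
  assumes "p > 0"
  shows "(\<Prod>i<p * k. f i) = (\<Prod>i<k. f (p * i)) * (\<Prod>j\<in>nonmultiples_below p (p * k). f j)"
  using lessThan_mult_split[OF assms, of k]
  by (simp add: prod.union_disjoint prod.reindex)

lemma prod_nonmultiples_below_reflect:
  fixes f :: "nat \<Rightarrow> 'a::comm_monoid_mult"
  shows "(\<Prod>j\<in>nonmultiples_below p (p * k). f (p * k - j)) = (\<Prod>j\<in>nonmultiples_below p (p * k). f j)"
proof (rule prod.reindex_bij_witness[of _ "\<lambda>j. p * k - j" "\<lambda>j. p * k - j"])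
  have *: "p * k - j \<in> nonmultiples_below p (p * k) \<and> p * k - (p * k - j) = j"
    if "j \<in> nonmultiples_below p (p * k)" for j
  proof -
    have j: "j < p * k" "\<not> p dvd j" using that by (simp_all add: nonmultiples_below_def)
    then have "j > 0" by (cases j) simp_all
    moreover have "\<not> p dvd p * k - j"
    proof
      assume "p dvd p * k - j"
      then have "p dvd p * k - (p * k - j)" by (rule dvd_diff_nat[rotated]) simp
      also have "p * k - (p * k - j) = j" using j by simp
      finally show False using j by simp
    qed
    ultimately show ?thesis using j by (simp add: nonmultiples_below_def)
  qed
  then show "p * k - (p * k - j) = j" "p * k - j \<in> nonmultiples_below p (p * k)"
    "p * k - (p * k - j) = j" "p * k - j \<in> nonmultiples_below p (p * k)"
    "f (p * k - j) = f (p * k - j)"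
    if "j \<in> nonmultiples_below p (p * k)" for j
    using that by auto
qed

lemma fact_mult_int_binomial:
  "fact m * int (n choose m) = (\<Prod>i<m. int n - int i)"
proof -
  have "(of_int (fact m * int (n choose m)) :: rat) = of_int (\<Prod>i<m. int n - int i)"
    by (simp only: of_int_mult of_int_fact of_int_of_nat_eq binomial_gbinomial
        gbinomial_mult_fact of_int_prod of_int_diff atLeast0LessThan)
  then show ?thesis by (simp only: of_int_eq_iff)
qed

text \<open>Split the falling factorial of \<open>p * n\<close> of length \<open>p * k\<close> by
  divisibility of the index by \<open>p\<close>: the multiples give \<open>p ^ k\<close> times the
  falling factorial of \<open>n\<close> of length \<open>k\<close>, the rest gives the ratio. The
  identity is cross-multiplied to stay in the integers.\<close>

lemma signed_binomial_mult_ratio: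
  assumes "p > 0"
  shows "((-1) ^ (p * k) * int ((p * n) choose (p * k))) * (\<Prod>j\<in>nonmultiples_below p (p * k). int j)
       = (-1) ^ k * int (n choose k) * (\<Prod>j\<in>nonmultiples_below p (p * k). int j - int (p * n))"
proof -
  let ?J = "nonmultiples_below p (p * k)"
  have split: "fact (p * k) * int ((p * m) choose (p * k))
      = int p ^ k * (fact k * int (m choose k)) * (\<Prod>j\<in>?J. int (p * m) - int j)" for m
    unfolding fact_mult_int_binomial prod_lessThan_mult_split[OF assms]
    by (simp add: right_diff_distrib[symmetric] prod.distrib)
  have "(\<Prod>j\<in>?J. int (p * k) - int j) = (\<Prod>j\<in>?J. int (p * k - j))"
    by (intro prod.cong) (auto simp: nonmultiples_below_def of_nat_diff)
  also have "\<dots> = (\<Prod>j\<in>?J. int j)"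
    by (rule prod_nonmultiples_below_reflect)
  finally have 1: "fact (p * k) = int p ^ k * fact k * (\<Prod>j\<in>?J. int j)"
    using split[of k] by simp
  have "(int p ^ k * fact k) * ((\<Prod>j\<in>?J. int j) * int ((p * n) choose (p * k)))
      = (int p ^ k * fact k) * (int (n choose k) * (\<Prod>j\<in>?J. int (p * n) - int j))"
    using split[of n] unfolding 1 by (simp add: mult_ac)
  then have 2: "(\<Prod>j\<in>?J. int j) * int ((p * n) choose (p * k))
      = int (n choose k) * (\<Prod>j\<in>?J. int (p * n) - int j)"
    using assms by simp
  have "(\<Prod>j\<in>?J. int (p * n) - int j) = (\<Prod>j\<in>?J. (-1) * (int j - int (p * n)))"
    by simp
  also have "\<dots> = (-1) ^ card ?J * (\<Prod>j\<in>?J. int j - int (p * n))"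
    by (simp only: prod.distrib prod_constant)
  finally have 3: "(\<Prod>j\<in>?J. int (p * n) - int j) = (-1) ^ card ?J * (\<Prod>j\<in>?J. int j - int (p * n))" .
  \<comment> \<open>Parity of the total sign: the cardinality is \<open>k * (p - 1)\<close>.\<close>
  have "p * k + card ?J = k + 2 * card ?J"
    unfolding card_nonmultiples_below[OF assms] using assms by (cases p) simp_all
  then have "(-1 :: int) ^ (p * k) * (-1) ^ card ?J = (-1) ^ k"
    by (metis power_add power_mult power_minus1_even mult_1_right power_mult_distrib)
  then show ?thesis using 2 unfolding 3 by (simp add: algebra_simps flip: mult.assoc)
qed

text \<open>The ring is general because the congruence serves for integers and for integer
  polynomials.\<close>

lemma prod_diff_dvd:
  fixes f g :: "'a \<Rightarrow> 'b::comm_ring_1"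
  assumes "\<And>i. i \<in> A \<Longrightarrow> d dvd f i - g i"
  shows "d dvd prod f A - prod g A"
  using assms
proof (induction A rule: infinite_finite_induct)
  case (insert x A)
  have "prod f (insert x A) - prod g (insert x A)
      = f x * (prod f A - prod g A) + (f x - g x) * prod g A"
    using insert.hyps by (simp add: algebra_simps)
  then show ?case using insert.IH insert.prems by simp
qed simp_all

section \<open>The product polynomial of the nonmultiples of \<open>p\<close>\<close>

lemma coeff_pcompose_scale:
  "coeff (pcompose f [:0, c:]) n = c ^ n * coeff f n" for c :: "'a::comm_semiring_1"
  by (induction f arbitrary: n) (simp_all add: pcompose_pCons coeff_pCons mult_ac split: nat.splits)

text \<open>Its values at \<open>0\<close> and \<open>p * n\<close> are the two products in
  \<open>signed_binomial_mult_ratio\<close>.\<close>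

definition nonmultiples_poly :: "nat \<Rightarrow> nat \<Rightarrow> int poly" where
  "nonmultiples_poly p k = (\<Prod>j\<in>nonmultiples_below p (p * k). [:int j, -1:])"

lemma poly_nonmultiples_poly:
  "poly (nonmultiples_poly p k) x = (\<Prod>j\<in>nonmultiples_below p (p * k). int j - x)"
  by (simp add: nonmultiples_poly_def poly_prod)

text \<open>Doubling permutes the residues prime to \<open>p\<close>, so the polynomial is invariant under
  \<open>X \<mapsto> 2 X\<close> modulo \<open>p\<close>.\<close>

lemma prime_dvd_coeff_2_nonmultiples_poly:
  assumes "prime p" "p \<ge> 5"
  shows "int p dvd coeff (nonmultiples_poly p k) 2"
proof -
  let ?J = "nonmultiples_below p (p * k)"
  define P where "P = nonmultiples_poly p k"
  \<comment> \<open>Doubles the residue inside each block of length \<open>p\<close>, so that the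
    range below \<open>p * k\<close> is preserved.\<close>
  define \<sigma> where "\<sigma> j = p * (j div p) + (2 * j) mod p" for j
  have p: "p > 0" using assms by simp
  have ndvd2: "\<not> p dvd 2" using assms by (auto dest: dvd_imp_le)
  have \<sigma>_mod: "\<sigma> j mod p = 2 * j mod p" for j by (simp add: \<sigma>_def)
  have \<sigma>_div: "\<sigma> j div p = j div p" for j using p by (simp add: \<sigma>_def)
  have "inj_on \<sigma> ?J"
  proof (rule inj_onI)
    fix i j assume "\<sigma> i = \<sigma> j"
    then have "i div p = j div p" "[2 * i = 2 * j] (mod p)"
      by (metis \<sigma>_div, metis \<sigma>_mod cong_def)
    moreover have "coprime 2 p" using assms ndvd2 by (metis coprime_commute prime_imp_coprime)
    ultimately show "i = j"
      by (metis cong_mult_lcancel_nat cong_def mult_div_mod_eq)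
  qed
  moreover have "\<sigma> ` ?J \<subseteq> ?J"
  proof
    fix i assume "i \<in> \<sigma> ` ?J"
    then obtain j where j: "j < p * k" "\<not> p dvd j" and i: "i = \<sigma> j"
      by (auto simp: nonmultiples_below_def)
    have "\<not> p dvd 2 * j" using j ndvd2 assms by (simp add: prime_dvd_mult_iff)
    then have "\<not> p dvd i" using \<sigma>_mod[of j] unfolding i by (simp add: dvd_eq_mod_eq_0)
    moreover have "i div p < k"
      using j p unfolding i \<sigma>_div by (simp add: div_less_iff_less_mult mult.commute)
    then have "i < p * k" using p by (simp add: div_less_iff_less_mult mult.commute)
    ultimately show "i \<in> ?J" by (simp add: nonmultiples_below_def)
  qed
  ultimately have bij: "bij_betw \<sigma> ?J ?J"
    by (simp add: bij_betw_def endo_inj_surj)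
  have "pcompose P [:0, 2:] = (\<Prod>j\<in>?J. [:int j, -2:])"
    by (simp add: P_def nonmultiples_poly_def pcompose_prod pcompose_pCons)
  also have "\<dots> = (\<Prod>j\<in>?J. [:int (\<sigma> j), -2:])"
    by (rule prod.reindex_bij_betw[OF bij, of "\<lambda>j. [:int j, -2:]", symmetric])
  finally have 1: "pcompose P [:0, 2:] = (\<Prod>j\<in>?J. [:int (\<sigma> j), -2:])" .
  have "(\<Prod>j\<in>?J. [:int (2 * j), -2:]) = (\<Prod>j\<in>?J. [:2:] * [:int j, -1:])"
    by (intro prod.cong) auto
  also have "\<dots> = [:2 ^ card ?J:] * P"
    by (simp only: prod.distrib prod_constant P_def nonmultiples_poly_def poly_const_pow)
  finally have 2: "(\<Prod>j\<in>?J. [:int (2 * j), -2:]) = [:2 ^ card ?J:] * P" .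
  have "[:int p:] dvd pcompose P [:0, 2:] - [:2 ^ card ?J:] * P"
    unfolding 1 2[symmetric]
  proof (rule prod_diff_dvd)
    fix j
    have "[\<sigma> j = 2 * j] (mod p)" by (simp add: cong_def \<sigma>_mod)
    then have "int p dvd int (\<sigma> j) - int (2 * j)"
      by (metis cong_int_iff cong_iff_dvd_diff)
    then show "[:int p:] dvd [:int (\<sigma> j), -2:] - [:int (2 * j), -2:]"
      by simp
  qed
  then have "int p dvd coeff (pcompose P [:0, 2:] - [:2 ^ card ?J:] * P) 2"
    by (simp only: const_poly_dvd_iff)
  then have 3: "int p dvd 4 * coeff P 2 - 2 ^ card ?J * coeff P 2"
    by (simp add: coeff_pcompose_scale)
  have "[2 ^ (p - 1) = 1] (mod p)" using assms ndvd2 by (intro fermat_theorem)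
  then have "[(2 ^ (p - 1)) ^ k = 1 ^ k] (mod p)" by (rule cong_pow)
  then have "[2 ^ card ?J = 1] (mod p)"
    unfolding card_nonmultiples_below[OF p] by (simp add: power_mult[symmetric] mult.commute)
  then have "int p dvd 2 ^ card ?J - 1"
    using cong_int_iff[of "2 ^ card ?J" 1 p] by (simp add: cong_iff_dvd_diff)
  \<comment> \<open>With \<open>2 ^ card ?J\<close> congruent to 1, invariance leaves
    \<open>(4 - 1) * coeff P 2\<close>; \<open>p = 3\<close> has to be excluded here.\<close>
  then have "int p dvd (4 * coeff P 2 - 2 ^ card ?J * coeff P 2) + (2 ^ card ?J - 1) * coeff P 2"
    using 3 by (intro dvd_add) auto
  then have "int p dvd 3 * coeff P 2" by (simp add: algebra_simps)
  moreover have "\<not> int p dvd 3" using assms by (auto dest: zdvd_imp_le)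
  ultimately show ?thesis using assms unfolding P_def by (simp add: prime_dvd_mult_iff)
qed

text \<open>The symmetry \<open>j \<mapsto> p k - j\<close> gives the polynomial the same value at \<open>0\<close> and \<open>p k\<close>.\<close>

lemma nonmultiples_poly_decomp:
  assumes "p > 0" "k > 0" "odd p \<or> even k"
  obtains R where "nonmultiples_poly p k
    = [:poly (nonmultiples_poly p k) 0:] + [:0, 1:] * ([:- int (p * k), 1:] * R)"
proof -
  let ?J = "nonmultiples_below p (p * k)"
  define P where "P = nonmultiples_poly p k"
  have "poly P (int (p * k)) = (\<Prod>j\<in>?J. - int (p * k - j))"
    unfolding P_def poly_nonmultiples_poly
    by (intro prod.cong) (auto simp: nonmultiples_below_def of_nat_diff)
  also have "\<dots> = (\<Prod>j\<in>?J. - int j)"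
    by (rule prod_nonmultiples_below_reflect[of "\<lambda>j. - int j"])
  also have "\<dots> = (\<Prod>j\<in>?J. int j)"
    using assms by (auto simp: prod_uminus card_nonmultiples_below)
  finally have eq: "poly P (int (p * k)) = poly P 0"
    by (simp add: P_def poly_nonmultiples_poly)
  have "poly (P - [:poly P 0:]) 0 = 0" by simp
  then obtain S where S: "P - [:poly P 0:] = [:0, 1:] * S"
    using poly_eq_0_iff_dvd[of "P - [:poly P 0:]" 0] by (auto elim: dvdE)
  have "poly (P - [:poly P 0:]) (int (p * k)) = 0" using eq by simp
  then have "poly S (int (p * k)) = 0" using assms unfolding S by simp
  then obtain R where "S = [:- int (p * k), 1:] * R"
    using poly_eq_0_iff_dvd[of S "int (p * k)"] by (auto elim: dvdE)
  with S have "P = [:poly P 0:] + [:0, 1:] * ([:- int (p * k), 1:] * R)"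
    by (simp add: algebra_simps)
  then show ?thesis using that unfolding P_def by blast
qed

text \<open>The decomposition gives the difference as \<open>p ^ 2 * n * (n - k)\<close> times a
  value of \<open>R\<close>. Here \<open>n\<close> contributes \<alpha> and \<open>n - k\<close>
  contributes \<gamma>; \<open>p ^ 2\<close> suffices for \<open>p = 2\<close> and
  \<open>p = 3\<close>, and for larger \<open>p\<close> the value of \<open>R\<close> supplies a
  third \<open>p\<close>. When \<open>p = 2\<close> and \<open>k\<close> is odd the symmetry fails,
  but then \<gamma> is 0 and divisibility by \<open>p * n\<close> is enough.\<close>

lemma prime_power_dvd_nonmultiples_poly_diff:
  assumes p: "prime p" and "k > 0" and n: "p ^ \<alpha> dvd n" and k: "p ^ \<gamma> dvd k" and "\<gamma> \<le> \<alpha>"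
  shows "int p ^ (\<alpha> + \<gamma> + delta p + 1) dvd
           poly (nonmultiples_poly p k) (int (p * n)) - poly (nonmultiples_poly p k) 0"
proof (cases "odd p \<or> even k")
  case False
  then have "p = 2" using p by (metis prime_odd_nat prime_ge_2_nat le_neq_implies_less)
  have "\<gamma> = 0"
  proof (rule ccontr)
    assume "\<gamma> \<noteq> 0"
    then have "2 dvd p ^ \<gamma>" using \<open>p = 2\<close> by simp
    then show False using k False by (metis dvd_trans)
  qed
  have "int (p * n) dvd poly (nonmultiples_poly p k) (int (p * n)) - poly (nonmultiples_poly p k) 0"
    unfolding poly_nonmultiples_poly by (rule prod_diff_dvd) simp
  moreover have "p ^ (\<alpha> + \<gamma> + delta p + 1) dvd p * n"
    using n by (simp add: \<open>\<gamma> = 0\<close> \<open>p = 2\<close> delta_def)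
  then have "int p ^ (\<alpha> + \<gamma> + delta p + 1) dvd int (p * n)"
    by (metis of_nat_dvd_iff of_nat_power)
  ultimately show ?thesis by (rule dvd_trans[rotated])
next
  case True
  define P where "P = nonmultiples_poly p k"
  have "p > 0" using p by (rule prime_gt_0_nat)
  obtain R where R: "P = [:poly P 0:] + [:0, 1:] * ([:- int (p * k), 1:] * R)"
    using nonmultiples_poly_decomp[OF \<open>p > 0\<close> \<open>k > 0\<close> True] unfolding P_def by blast
  have "poly P (int (p * n)) = poly P 0 + int (p * n) * ((int (p * n) - int (p * k)) * poly R (int (p * n)))"
    by (subst R) (simp add: algebra_simps)
  then have diff: "poly P (int (p * n)) - poly P 0
      = (int n * (int n - int k)) * (int p ^ 2 * poly R (int (p * n)))"
    by (simp add: algebra_simps power2_eq_square)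
  have "int p ^ \<alpha> dvd int n" using n by (metis of_nat_dvd_iff of_nat_power)
  moreover have "int p ^ \<gamma> dvd int n - int k"
    using k dvd_trans[OF le_imp_power_dvd[OF \<open>\<gamma> \<le> \<alpha>\<close>] n] by (metis dvd_diff of_nat_dvd_iff of_nat_power)
  ultimately have 1: "int p ^ (\<alpha> + \<gamma>) dvd int n * (int n - int k)"
    unfolding power_add by (rule mult_dvd_mono)
  have 2: "int p ^ (delta p + 1) dvd int p ^ 2 * poly R (int (p * n))"
  proof (cases "p \<ge> 5")
    case False
    then have "p = 2 \<or> p = 3 \<or> p = 4" using prime_ge_2_nat[OF p] by auto
    moreover have "\<not> prime (4::nat)" using prime_odd_nat[of 4] by auto
    ultimately have "delta p + 1 \<le> 2" using p by (auto simp: delta_def)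
    then show ?thesis by (metis dvd_mult2 le_imp_power_dvd)
  next
    case True
    have "coeff P 2 = coeff R 0 - int (p * k) * coeff R 1"
      by (subst R) (simp add: numeral_2_eq_2 coeff_pCons)
    then have "coeff R 0 = coeff P 2 + int p * (int k * coeff R 1)" by simp
    then have "int p dvd coeff R 0"
      using prime_dvd_coeff_2_nonmultiples_poly[OF p True, of k] by (simp add: P_def)
    moreover obtain a S where S: "R = pCons a S" by (cases R)
    ultimately have "int p dvd poly R (int (p * n))" by simp
    then have "int p ^ 2 * int p dvd int p ^ 2 * poly R (int (p * n))" by (rule mult_dvd_mono[OF dvd_refl])
    moreover have "delta p = 2" using True by (simp add: delta_def)
    ultimately show ?thesis by (simp add: power2_eq_square numeral_3_eq_3 mult.assoc)
  qed
  show ?thesis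
    using mult_dvd_mono[OF 1 2]
    unfolding P_def[symmetric] diff power_add[symmetric] by (simp only: add.assoc)
qed

text \<open>From \<open>k * (n choose k) = n * ((n - 1) choose (k - 1))\<close>.\<close>

lemma prime_power_dvd_binomial:
  assumes p: "prime p" and n: "p ^ \<alpha> dvd n" and k: "k > 0"
  shows "p ^ (\<alpha> - min \<alpha> (multiplicity p k)) dvd n choose k"
proof (cases "\<alpha> \<le> multiplicity p k")
  case False
  define \<beta> where "\<beta> = multiplicity p k"
  obtain k' where k': "k = p ^ \<beta> * k'" "\<not> p dvd k'"
    using multiplicity_decompose'[of k p] p k unfolding \<beta>_def by (metis not_gr_zero not_prime_unit)
  have "k * (n choose k) = n * ((n - 1) choose (k - 1))"
    using k times_binomial_minus1_eq by blast
  then have "p ^ \<alpha> dvd p ^ \<beta> * (k' * (n choose k))"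
    using n k'(1) by (metis dvd_mult2 mult.assoc)
  then have "p ^ \<beta> * p ^ (\<alpha> - \<beta>) dvd p ^ \<beta> * (k' * (n choose k))"
    using False by (simp add: power_add[symmetric] \<beta>_def)
  then have "p ^ (\<alpha> - \<beta>) dvd k' * (n choose k)"
    using prime_gt_0_nat[OF p] by simp
  moreover have "coprime (p ^ (\<alpha> - \<beta>)) k'"
    using p k'(2) by (simp add: prime_imp_coprime)
  ultimately show ?thesis using False by (simp add: coprime_dvd_mult_right_iff \<beta>_def)
qed simp

text \<open>The loss in \<open>n choose k\<close> and the gain in the difference of the products
  balance, so the exponent does not depend on \<open>k\<close>. The product \<open>poly P 0\<close>
  is prime to \<open>p\<close> and cancels.\<close>

lemma prime_power_dvd_signed_binomial_diff:
  assumes p: "prime p" and n: "p ^ \<alpha> dvd n"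
  shows "int p ^ (2 * \<alpha> + delta p + 1) dvd
           (-1) ^ (p * k) * int ((p * n) choose (p * k)) - (-1) ^ k * int (n choose k)"
proof (cases "k = 0")
  case False
  define \<gamma> where "\<gamma> = min \<alpha> (multiplicity p k)"
  define P where "P = nonmultiples_poly p k"
  let ?G = "(-1) ^ (p * k) * int ((p * n) choose (p * k)) - (-1) ^ k * int (n choose k)"
  have "p ^ \<gamma> dvd k" by (intro multiplicity_dvd') (simp add: \<gamma>_def)
  then have 1: "int p ^ (\<alpha> + \<gamma> + delta p + 1) dvd poly P (int (p * n)) - poly P 0"
    unfolding P_def using False
    by (intro prime_power_dvd_nonmultiples_poly_diff[OF p _ n]) (simp_all add: \<gamma>_def)
  have "p ^ (\<alpha> - \<gamma>) dvd n choose k"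
    using prime_power_dvd_binomial[OF p n, of k] False by (simp add: \<gamma>_def)
  then have 2: "int p ^ (\<alpha> - \<gamma>) dvd (-1) ^ k * int (n choose k)"
    by (metis dvd_mult of_nat_dvd_iff of_nat_power)
  have "\<gamma> \<le> \<alpha>" by (simp add: \<gamma>_def)
  then have "2 * \<alpha> + delta p + 1 = (\<alpha> - \<gamma>) + (\<alpha> + \<gamma> + delta p + 1)" by simp
  then have "int p ^ (2 * \<alpha> + delta p + 1) dvd
      ((-1) ^ k * int (n choose k)) * (poly P (int (p * n)) - poly P 0)"
    using mult_dvd_mono[OF 2 1] by (simp only: power_add)
  also have "\<dots> = ?G * poly P 0"
    using signed_binomial_mult_ratio[OF prime_gt_0_nat[OF p], of k n]
    by (simp add: P_def poly_nonmultiples_poly algebra_simps)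
  finally have "int p ^ (2 * \<alpha> + delta p + 1) dvd ?G * poly P 0" .
  moreover have "\<not> int p dvd poly P 0"
    using p by (auto simp: P_def poly_nonmultiples_poly prime_dvd_prod_iff nonmultiples_below_def)
  then have "coprime (int p ^ (2 * \<alpha> + delta p + 1)) (poly P 0)"
    using p by (simp add: prime_imp_coprime)
  ultimately show ?thesis by (simp add: coprime_dvd_mult_left_iff)
qed simp

section \<open>The difference of two brackets\<close>

lemma coeff_sum_with_sum:
  "coeff_sum_with g (\<Sum>i\<in>A. f i) = (\<Sum>i\<in>A. coeff_sum_with g (f i))"
proof (induction A rule: infinite_finite_induct)
  case (insert x A)
  then show ?case by (simp add: coeff_sum_with_add)
qed (simp_all add: coeff_sum_with_def)

lemma coeff_sum_with_one_minus_power: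
  "coeff_sum_with g ([:1, -1:] ^ n) = (\<Sum>k\<le>n. (-1) ^ k * int (n choose k) * g k)"
  by (simp add: coeff_sum_with_def degree_power_eq coeff_linear_poly_power mult.commute)

text \<open>Newton's forward difference formula for \<open>g\<close>: the sums at
  \<open>(y - 1) ^ m\<close> are the differences of \<open>g\<close> at 0, and
  \<open>y ^ k = ((y - 1) + 1) ^ k\<close>.\<close>

lemma sum_mult_eq_sum_binomial_moments:
  fixes G g :: "nat \<Rightarrow> int"
  shows "(\<Sum>k\<le>n. G k * g k)
       = (\<Sum>m\<le>n. (\<Sum>k\<le>n. G k * int (k choose m)) * coeff_sum_with g ([:-1, 1:] ^ m))"
proof -
  have g: "g k = (\<Sum>m\<le>n. int (k choose m) * coeff_sum_with g ([:-1, 1:] ^ m))" if "k \<le> n" for k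
  proof -
    have "coeff_sum_with g (monom 1 k) = g k"
      using coeff_sum_with_monom_mult[of g k 1] by (simp add: coeff_sum_with_def)
    moreover have "monom (1::int) k = ([:-1, 1:] + 1) ^ k"
      by (simp add: monom_altdef one_pCons)
    then have "monom (1::int) k = (\<Sum>m\<le>k. of_nat (k choose m) * [:-1, 1:] ^ m)"
      by (simp add: binomial_ring)
    ultimately have "g k = (\<Sum>m\<le>k. int (k choose m) * coeff_sum_with g ([:-1, 1:] ^ m))"
      by (simp only: coeff_sum_with_sum coeff_sum_with_of_nat_mult)
    also have "\<dots> = (\<Sum>m\<le>n. int (k choose m) * coeff_sum_with g ([:-1, 1:] ^ m))"
      using that by (intro sum.mono_neutral_left) auto
    finally show ?thesis .
  qed
  have "(\<Sum>k\<le>n. G k * g k)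
      = (\<Sum>k\<le>n. \<Sum>m\<le>n. G k * (int (k choose m) * coeff_sum_with g ([:-1, 1:] ^ m)))"
    unfolding sum_distrib_left[symmetric] by (rule sum.cong) (simp_all flip: g)
  also have "\<dots> = (\<Sum>m\<le>n. \<Sum>k\<le>n. G k * (int (k choose m) * coeff_sum_with g ([:-1, 1:] ^ m)))"
    by (rule sum.swap)
  finally show ?thesis by (simp add: sum_distrib_right mult.assoc)
qed

lemma choose_weight_scale:
  assumes "p > 0"
  shows "choose_weight (p * q) l (int p * r) (p * k) = choose_weight q l r k"
    and "\<not> p dvd j \<Longrightarrow> choose_weight (p * q) l (int p * r) j = 0"
proof -
  have "int (p * k) - int p * r = int p * (int k - r)" by (simp add: algebra_simps)
  then show "choose_weight (p * q) l (int p * r) (p * k) = choose_weight q l r k"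
    using assms by (simp add: choose_weight_def)
  assume j: "\<not> p dvd j"
  have "\<not> int (p * q) dvd int j - int p * r"
  proof
    assume "int (p * q) dvd int j - int p * r"
    then have "int p dvd int j - int p * r" by (metis dvd_mult_left of_nat_mult)
    then have "int p dvd (int j - int p * r) + int p * r" by (rule dvd_add) simp
    then show False using j by simp
  qed
  then show "choose_weight (p * q) l (int p * r) j = 0"
    by (simp add: choose_weight_def)
qed

text \<open>The class of \<open>p * r\<close> modulo \<open>p * q\<close> consists of multiples of
  \<open>p\<close>. Used for the larger bracket and, with \<open>q = 1\<close> and
  \<open>r = 0\<close>, for the moments.\<close>

lemma sum_choose_weight_scale:
  assumes "p > 0"
  shows "(\<Sum>j\<le>p * n. f j * choose_weight (p * q) l (int p * r) j)
       = (\<Sum>k\<le>n. f (p * k) * choose_weight q l r k)"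
proof -
  have "(\<Sum>j\<le>p * n. f j * choose_weight (p * q) l (int p * r) j)
      = (\<Sum>j\<in>(\<lambda>k. p * k) ` {..n}. f j * choose_weight (p * q) l (int p * r) j)"
    using assms
    by (intro sum.mono_neutral_right) (auto simp: image_iff Bex_def elim: dvdE
        intro!: choose_weight_scale(2))
  also have "\<dots> = (\<Sum>k\<le>n. f (p * k) * choose_weight q l r k)"
    using assms by (simp add: sum.reindex inj_on_def choose_weight_scale(1))
  finally show ?thesis .
qed

lemma coeff_sum_choose_weight_one_minus_monom_power:
  assumes "q > 0" "l < n"
  shows "coeff_sum_with (choose_weight q l r) ((1 - monom 1 q) ^ n) = 0"
  using assms(2)
proof (induction l arbitrary: n)
  case 0
  then show ?case
    using coeff_sum_choose_weight_one_minus_monom(1)[OF assms(1)] by (cases n) auto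
next
  case (Suc l)
  then show ?case
    using coeff_sum_choose_weight_one_minus_monom(2)[OF assms(1)] by (cases n) auto
qed

definition bracket_diff_coeff :: "nat \<Rightarrow> nat \<Rightarrow> nat \<Rightarrow> int" where
  "bracket_diff_coeff p n k =
     (-1) ^ (p * k) * int ((p * n) choose (p * k)) - (-1) ^ k * int (n choose k)"

text \<open>The function \<open>k choose m\<close> is the weight of modulus 1. Its
  \<open>m + 1\<close> first differences kill the part from \<open>n choose k\<close>; the other
  part is a sum of modulus \<open>p\<close>, and the numerical hypothesis is that of
  \<open>prime_power_dvd_coeff_sum_choose_weight\<close> at \<open>c = 0\<close>.\<close>

lemma prime_power_dvd_bracket_diff_moment:
  assumes p: "prime p" and "m < n" and "1 + m * p + (p - 1) * t \<le> p * n"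
  shows "int p ^ t dvd (\<Sum>k\<le>n. bracket_diff_coeff p n k * int (k choose m))"
proof -
  have w: "choose_weight 1 m 0 k = int (k choose m)" for k
    by (simp add: choose_weight_def int_choose_of_nat)
  have "(\<Sum>k\<le>n. (-1) ^ k * int (n choose k) * int (k choose m))
      = coeff_sum_with (choose_weight 1 m 0) ([:1, -1:] ^ n)"
    by (simp only: coeff_sum_with_one_minus_power w)
  also have "[:1, -1:] = 1 - monom (1::int) 1"
    by (simp add: monom_altdef one_pCons)
  also have "coeff_sum_with (choose_weight 1 m 0) ((1 - monom 1 1) ^ n) = 0"
    using \<open>m < n\<close> by (intro coeff_sum_choose_weight_one_minus_monom_power) auto
  finally have 1: "(\<Sum>k\<le>n. (-1) ^ k * int (n choose k) * int (k choose m)) = 0" .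
  have "(\<Sum>k\<le>n. (-1) ^ (p * k) * int ((p * n) choose (p * k)) * int (k choose m))
      = (\<Sum>j\<le>p * n. (-1) ^ j * int ((p * n) choose j) * choose_weight p m 0 j)"
    using sum_choose_weight_scale[OF prime_gt_0_nat[OF p],
        where f = "\<lambda>j. (-1) ^ j * int ((p * n) choose j)" and n = n and q = 1 and l = m and r = 0]
    by (simp only: w mult_zero_right mult_1_right)
  also have "\<dots> = coeff_sum_with (choose_weight p m 0) ([:1, -1:] ^ (p * n))"
    by (simp only: coeff_sum_with_one_minus_power)
  finally have 2: "(\<Sum>k\<le>n. (-1) ^ (p * k) * int ((p * n) choose (p * k)) * int (k choose m))
      = coeff_sum_with (choose_weight p m 0) ([:1, -1:] ^ (p * n))" .
  have "int p ^ t dvd coeff_sum_with (choose_weight (p ^ Suc 0) m 0) ([:1, -1:] ^ (p * n) * 1)"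
    by (rule prime_power_dvd_coeff_sum_choose_weight[OF p]) (use assms in simp)
  then show ?thesis
    by (simp add: bracket_diff_coeff_def left_diff_distrib sum_subtractf 1 2)
qed

text \<open>The moment of index \<open>n - d\<close> is divisible by \<open>p ^ (M + 1)\<close> and by
  \<open>p ^ (d - 1 + s)\<close>, where \<open>s\<close> is \<open>d / (p - 1)\<close> rounded up, while its cofactor loses at most a
  factor \<open>p ^ s\<close>. Taking the better of the two bounds on either side of \<open>d = K + 1\<close> gives \<open>K\<close>.\<close>

lemma prime_power_dvd_bracket_diff_sum:
  assumes p: "prime p" and n: "p ^ \<alpha> dvd n"
    and E: "E = 0 \<or> p ^ c + l * p ^ Suc c + p ^ c * (p - 1) * E \<le> n"
    and M: "M = 2 * \<alpha> + delta p" and K: "K = M - M div p"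
  shows "int p ^ (K + E) dvd (\<Sum>k\<le>n. bracket_diff_coeff p n k * choose_weight (p ^ Suc c) l r k)"
proof (subst sum_mult_eq_sum_binomial_moments, rule dvd_sum)
  fix m assume "m \<in> {..n}"
  then have "m \<le> n" by simp
  define A where "A = (\<Sum>k\<le>n. bracket_diff_coeff p n k * int (k choose m))"
  define B where "B = coeff_sum_with (choose_weight (p ^ Suc c) l r) ([:-1, 1:] ^ m)"
  have p2: "p \<ge> 2" using p by (rule prime_ge_2_nat)
  define d where "d = n - m"
  define s where "s = (d + p - 2) div (p - 1)"
  have s1: "d \<le> (p - 1) * s"
  proof -
    have "d + p - 2 = (p - 1) * s + (d + p - 2) mod (p - 1)"
      unfolding s_def by simp
    moreover have "(d + p - 2) mod (p - 1) < p - 1" using p2 by simp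
    ultimately have "d + p - 2 < (p - 1) * s + (p - 1)" by linarith
    then show ?thesis by linarith
  qed
  have s2: "(p - 1) * s \<le> d + p - 2"
    unfolding s_def by simp
  have A: "int p ^ (M + 1) dvd A"
    unfolding A_def M using prime_power_dvd_signed_binomial_diff[OF p n]
    by (intro dvd_sum dvd_mult2) (simp add: bracket_diff_coeff_def)
  have A': "int p ^ (d - 1 + s) dvd A" if "d > 0"
    unfolding A_def
  proof (rule prime_power_dvd_bracket_diff_moment[OF p])
    show "m < n" using that by (simp add: d_def)
    \<comment> \<open>The rounding in \<open>s\<close> costs at most \<open>p - 2\<close>, and the
      total is exactly the permitted \<open>p * d - 1\<close>.\<close>
    have "(p - 1) * (d - 1 + s) \<le> (p - 1) * (d - 1) + (d + p - 2)"
      using s2 by (simp add: distrib_left)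
    also have "\<dots> = p * d - 1"
      using that p2 by (cases d; cases p) (simp_all add: algebra_simps)
    finally have "1 + (p - 1) * (d - 1 + s) \<le> p * d"
      using that p2 by (cases "p * d") auto
    moreover have "p * n = m * p + p * d"
      using \<open>m \<le> n\<close> by (simp add: d_def algebra_simps flip: distrib_left)
    ultimately show "1 + m * p + (p - 1) * (d - 1 + s) \<le> p * n" by linarith
  qed
  \<comment> \<open>Dropping from \<open>n\<close> to \<open>m\<close> loses \<open>d\<close>
    factors, at most \<open>s\<close> times the totient. For \<open>E = 0\<close> the bound on
    \<open>n\<close> may fail, but the claim is trivial.\<close>
  have B: "int p ^ (E - s) dvd B"
  proof (cases "E - s = 0")
    case False
    have "[:-1, 1 :: int:] = [:1, -1:] * [:-1:]" by simp
    then have Bm: "[:-1, 1 :: int:] ^ m = [:1, -1:] ^ m * [:-1:] ^ m"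
      by (simp only: power_mult_distrib)
    have nd: "n = m + d" using \<open>m \<le> n\<close> by (simp add: d_def)
    have E': "p ^ c + l * p ^ Suc c + p ^ c * (p - 1) * E \<le> n" using E False by auto
    have "d \<le> p ^ c * (p - 1) * s"
      using s1 p2 by (metis le_trans mult.assoc mult_le_mono1 nat_mult_1 one_le_power order.trans one_le_numeral)
    moreover have "p ^ c * (p - 1) * E = p ^ c * (p - 1) * (E - s) + p ^ c * (p - 1) * s"
      using False by (simp flip: distrib_left)
    ultimately have "p ^ c + l * p ^ Suc c + p ^ c * (p - 1) * (E - s) \<le> m"
      using E' nd by linarith
    then show ?thesis
      unfolding B_def Bm by (rule prime_power_dvd_coeff_sum_choose_weight[OF p])
  qed simp
  have "\<exists>t. int p ^ t dvd A \<and> K + s \<le> t"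
  proof (cases "d \<le> K")
    case True
    have KM: "K + M div p = M" unfolding K by simp
    have "M = p * (M div p) + M mod p" by simp
    moreover have "M mod p < p" using p2 by simp
    ultimately have "M + 1 \<le> p * (M div p) + p" by linarith
    then have "d + (M div p) + 1 \<le> p * (M div p) + p"
      using True KM by linarith
    then have "d \<le> (p - 1) * (M div p + 1)"
      using p2 by (simp add: diff_mult_distrib)
    then have "(p - 1) * s < (p - 1) * (M div p + 2)"
      using s2 p2 by (simp add: distrib_left)
    then have "s < M div p + 2" by (simp only: mult_less_cancel1)
    then have "K + s \<le> M + 1" using KM by linarith
    then show ?thesis using A by blast
  next
    case False
    then have "K + s \<le> d - 1 + s" "d > 0" by auto
    then show ?thesis using A' by blast
  qed
  then obtain t where t: "int p ^ t dvd A" "K + s \<le> t" by blast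
  \<comment> \<open>Also valid when \<open>E < s\<close> and the subtraction truncates, since
    \<open>t\<close> is at least \<open>K + s\<close>.\<close>
  then have "int p ^ (K + E) dvd int p ^ (t + (E - s))"
    by (intro le_imp_power_dvd) linarith
  also have "\<dots> dvd A * B"
    unfolding power_add using t(1) B by (rule mult_dvd_mono)
  finally show "int p ^ (K + E) dvd A * B" .
qed

section \<open>From integer sums back to the brackets\<close>

definition bracket_exponent :: "nat \<Rightarrow> nat \<Rightarrow> nat \<Rightarrow> nat \<Rightarrow> int" where
  "bracket_exponent p b l n =
     \<lfloor>(of_nat n - of_nat (p ^ (b - 1)) - of_nat (l * p ^ b)) / (of_nat (totient (p ^ b)) :: rat)\<rfloor>"

text \<open>Numerator and totient are both multiplied by \<open>p\<close>.\<close>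

lemma bracket_exponent_scale:
  assumes "prime p"
  shows "bracket_exponent p (Suc (Suc c)) l (p * n) = bracket_exponent p (Suc c) l n"
proof -
  have p: "of_nat p \<noteq> (0::rat)" using prime_gt_0_nat[OF assms] by simp
  have 1: "of_nat (p * n) - of_nat (p ^ Suc c) - of_nat (l * p ^ Suc (Suc c))
      = of_nat p * (of_nat n - of_nat (p ^ c) - of_nat (l * p ^ Suc c) :: rat)"
    by (simp add: algebra_simps)
  have 2: "of_nat (totient (p ^ Suc (Suc c))) = of_nat p * (of_nat (totient (p ^ Suc c)) :: rat)"
    unfolding totient_prime_power_Suc[OF assms] by simp
  show ?thesis
    unfolding bracket_exponent_def diff_Suc_1 1 2 using p by simp
qed

lemma bracket_exponent_le:
  assumes "prime p" "0 < bracket_exponent p (Suc c) l n"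
  shows "p ^ c + l * p ^ Suc c + p ^ c * (p - 1) * nat (bracket_exponent p (Suc c) l n) \<le> n"
proof -
  define E where "E = nat (bracket_exponent p (Suc c) l n)"
  have pos: "totient (p ^ Suc c) > 0"
    using prime_gt_0_nat[OF assms(1)] by simp
  have "of_int (bracket_exponent p (Suc c) l n)
      \<le> (of_nat n - of_nat (p ^ c) - of_nat (l * p ^ Suc c)) / (of_nat (totient (p ^ Suc c)) :: rat)"
    unfolding bracket_exponent_def diff_Suc_1 by (rule of_int_floor_le)
  also have "of_int (bracket_exponent p (Suc c) l n) = (of_nat E :: rat)"
    using assms(2) by (simp add: E_def)
  finally have "of_nat E * of_nat (totient (p ^ Suc c))
      \<le> (of_nat n - of_nat (p ^ c) - of_nat (l * p ^ Suc c) :: rat)"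
    using pos by (simp only: pos_le_divide_eq of_nat_0_less_iff)
  then have "of_nat (E * totient (p ^ Suc c) + p ^ c + l * p ^ Suc c) \<le> (of_nat n :: rat)"
    by (simp add: algebra_simps)
  then have "E * totient (p ^ Suc c) + p ^ c + l * p ^ Suc c \<le> n"
    by (simp only: of_nat_le_iff)
  then show ?thesis
    by (simp only: totient_prime_power_Suc[OF assms(1)] E_def ac_simps)
qed

lemma bracket_eq:
  "bracket p b l n r = of_nat p powi (- bracket_exponent p b l n) *
     of_int (\<Sum>k\<le>n. (-1) ^ k * int (n choose k) * choose_weight (p ^ b) l r k)"
proof -
  have "(\<Sum>k | k \<le> n \<and> [int k = r] (mod int (p ^ b)).
        (- 1) ^ k * of_nat (n choose k) * ((of_int (int k - r) / of_nat (p ^ b) :: rat) gchoose l))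
      = (\<Sum>k\<le>n. (- 1) ^ k * of_nat (n choose k) * of_int (choose_weight (p ^ b) l r k))"
  proof (rule sum.mono_neutral_cong_left)
    show "\<forall>k\<in>{..n} - {k. k \<le> n \<and> [int k = r] (mod int (p ^ b))}.
        (- 1) ^ k * of_nat (n choose k) * (of_int (choose_weight (p ^ b) l r k) :: rat) = 0"
      by (auto simp: choose_weight_def cong_iff_dvd_diff)
    fix k assume "k \<in> {k. k \<le> n \<and> [int k = r] (mod int (p ^ b))}"
    then have dvd: "int (p ^ b) dvd int k - r" by (simp add: cong_iff_dvd_diff)
    then have "of_int (int k - r) / of_nat (p ^ b) = (of_int ((int k - r) div int (p ^ b)) :: rat)"
      by (metis of_int_div of_int_of_nat_eq)
    then show "(- 1) ^ k * of_nat (n choose k) * ((of_int (int k - r) / of_nat (p ^ b) :: rat) gchoose l)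
        = (- 1) ^ k * of_nat (n choose k) * of_int (choose_weight (p ^ b) l r k)"
      using dvd by (simp only: choose_weight_def if_True of_int_int_choose)
  qed auto
  then show ?thesis
    unfolding bracket_def bracket_exponent_def by simp
qed

lemma bracket_diff_eq:
  assumes "prime p"
  shows "bracket p (Suc (Suc c)) l (p * n) (int p * r) - bracket p (Suc c) l n r
       = of_nat p powi (- bracket_exponent p (Suc c) l n) *
           of_int (\<Sum>k\<le>n. bracket_diff_coeff p n k * choose_weight (p ^ Suc c) l r k)"
proof -
  have "(\<Sum>k\<le>p * n. (-1) ^ k * int ((p * n) choose k) * choose_weight (p ^ Suc (Suc c)) l (int p * r) k)
      = (\<Sum>k\<le>n. (-1) ^ (p * k) * int ((p * n) choose (p * k)) * choose_weight (p ^ Suc c) l r k)"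
    using sum_choose_weight_scale[OF prime_gt_0_nat[OF assms],
        where f = "\<lambda>j. (-1) ^ j * int ((p * n) choose j)" and n = n and q = "p ^ Suc c" and l = l and r = r]
    by (simp only: power_Suc)
  then show ?thesis
    unfolding bracket_eq bracket_exponent_scale[OF assms]
    by (simp only: bracket_diff_coeff_def left_diff_distrib right_diff_distrib sum_subtractf of_int_diff)
qed

lemma padic_ord_geI:
  assumes "x = of_nat (p ^ m) * of_int z"
  shows "ereal (real m) \<le> padic_ord p x"
  unfolding padic_ord_def using assms by (intro SUP_upper) blast

theorem theorem1p4:
  fixes p a n l :: nat and r :: int
  assumes "prime p" and "a > 0" and "n > 0"
  shows "padic_ord p (bracket p (a + 1) l (p * n) (int p * r) - bracket p a l n r)
           \<ge> ereal ((real p - 1) / real p) * (2 * padic_ord p (of_nat n) + ereal (real (delta p)))"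
proof -
  obtain c where a: "a = Suc c" using \<open>a > 0\<close> gr0_conv_Suc by blast
  define \<alpha> where "\<alpha> = multiplicity (int p) (int n)"
  define M where "M = 2 * \<alpha> + delta p"
  \<comment> \<open>This is \<open>(p - 1) / p * M\<close> rounded up.\<close>
  define K where "K = M - M div p"
  define e where "e = bracket_exponent p a l n"
  define E where "E = nat e"
  have p: "p > 0" using \<open>prime p\<close> by (rule prime_gt_0_nat)
  have "int p ^ \<alpha> dvd int n" unfolding \<alpha>_def by (rule multiplicity_dvd)
  then have n: "p ^ \<alpha> dvd n" by (metis of_nat_dvd_iff of_nat_power)
  have "E = 0 \<or> p ^ c + l * p ^ Suc c + p ^ c * (p - 1) * E \<le> n"
    using bracket_exponent_le[OF \<open>prime p\<close>, of c l n] by (cases "e \<le> 0") (auto simp: E_def e_def a)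
  then have "int p ^ (K + E) dvd (\<Sum>k\<le>n. bracket_diff_coeff p n k * choose_weight (p ^ a) l r k)"
    unfolding a by (rule prime_power_dvd_bracket_diff_sum[OF \<open>prime p\<close> n _ M_def K_def])
  then obtain z where z: "(\<Sum>k\<le>n. bracket_diff_coeff p n k * choose_weight (p ^ a) l r k)
      = int p ^ (K + E) * z"
    by (elim dvdE)
  \<comment> \<open>For nonnegative \<open>e\<close> the powers cancel; for negative
    \<open>e\<close> we have \<open>E = 0\<close> and a positive power of \<open>p\<close> remains,
    which only helps.\<close>
  have "of_nat p powi (- e) * of_nat p ^ E = (of_nat p powi (- e) * of_nat p powi int E :: rat)"
    by simp
  also have "\<dots> = of_nat p powi int (nat (- e))"
    using p by (subst power_int_add[symmetric]) (auto simp: E_def intro: arg_cong)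
  finally have cancel: "of_nat p powi (- e) * of_nat p ^ E = (of_nat p ^ nat (- e) :: rat)"
    by (simp only: power_int_of_nat)
  have "bracket p (a + 1) l (p * n) (int p * r) - bracket p a l n r
      = of_nat p powi (- e) * of_int (int p ^ (K + E) * z)"
    unfolding z[symmetric] e_def a Suc_eq_plus1[symmetric] by (rule bracket_diff_eq[OF \<open>prime p\<close>])
  also have "\<dots> = of_nat (p ^ K) * (of_nat p powi (- e) * of_nat p ^ E) * of_int z"
    by (simp add: power_add)
  also have "\<dots> = of_nat (p ^ K) * of_int (int p ^ nat (- e) * z)"
    unfolding cancel by simp
  finally have K: "ereal (real K)
      \<le> padic_ord p (bracket p (a + 1) l (p * n) (int p * r) - bracket p a l n r)"
    by (rule padic_ord_geI)
  have "padic_ord p (of_nat n) = ereal (real \<alpha>)"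
    using padic_ord_of_int[OF \<open>prime p\<close>, of "int n"] \<open>n > 0\<close> by (simp add: \<alpha>_def)
  then have eq: "ereal ((real p - 1) / real p) * (2 * padic_ord p (of_nat n) + ereal (real (delta p)))
      = ereal ((real p - 1) / real p * real M)"
    by (simp add: M_def)
  have "(real p - 1) / real p * real M = real M - real M / real p"
    using p by (simp add: field_simps)
  also have "\<dots> \<le> real M - real (M div p)"
    using of_nat_div_le_of_nat[of M p, where 'a = real] by simp
  also have "\<dots> = real K"
    unfolding K_def by (simp add: of_nat_diff)
  finally show ?thesis
    unfolding eq using K by (meson ereal_less_eq(3) order.trans)
qed

end
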